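(* Let $\vec n\in\mathbb N_0^p$, $\vec m\in\mathbb N_0^q$ with $|\vec m|=|\vec n|+1$. Up to a nonzero constant, the type-II mixed Piñeiro form $B_{\vec n,\vec m}$ has, for $0<x<1$, the contour representation $$B_{\vec n,\vec m}(x)=\int_\Sigma\frac{x^t\prod_{i=1}^p(t+\alpha_i+1)_{n_i}}{\prod_{j=1}^q(\beta_j-t)_{m_j}}\,\frac{\mathrm dt}{2\pi\mathrm i},$$ where $\Sigma$ is a clockwise contour enclosing once every pole $\beta_j,\beta_j+1,\ldots,\beta_j+m_j-1$, $1\le j\le q$, of the integrand, and $x^t=\exp(t\log x)$ with the real logarithm.
   Context: $p,q\ge1$; real parameters satisfy $\alpha_i>-1$, $\beta_j>-1$, $\alpha_i+\beta_j>-1$ for all $1\le i\le p$, $1\le j\le q$; $\alpha_i-\alpha_h\notin\mathbb Z$ for $i\ne h$ and $\beta_j-\beta_s\notin\mathbb Z$ for $j\neq s$. $(z)_0=1$, $(z)_n=\prod_{r=0}^{n-1}(z+r)$; $|\cdot|$ is the sum of components of a multi-index. For $|\vec m|=|\vec n|+1$, a type-II mixed Piñeiro form is a nonzero function $B_{\vec n,\vec m}(x)=\sum_{j=1}^qB^{(j)}_{\vec n,\vec m}(x)x^{\beta_j}$ with polynomials $\deg B^{(j)}_{\vec n,\vec m}\le m_j-1$ ($B^{(j)}\equiv0$ if $m_j=0$) such that $\int_0^1B_{\vec n,\vec m}(x)x^{k+\alpha_i}\,\mathrm dx=0$ for $0\le k\le n_i-1$, $1\le i\le p$. Under the parameter assumptions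 the system is perfect (known fact): such a form is unique up to a nonzero constant factor. *)

theory Defs
  imports "HOL-Complex_Analysis.Complex_Analysis" "HOL-Computational_Algebra.Polynomial"
begin

text \<open>
  Multi-indices and parameter vectors are functions on \<open>nat\<close> of which only the values on
  \<open>{1..p}\<close> resp. \<open>{1..q}\<close> matter.
\<close>

definition pineiro_params :: "nat \<Rightarrow> nat \<Rightarrow> (nat \<Rightarrow> real) \<Rightarrow> (nat \<Rightarrow> real) \<Rightarrow> bool" where
  "pineiro_params p q \<alpha> \<beta> \<longleftrightarrow>
     p \<ge> 1 \<and> q \<ge> 1 \<and>
     (\<forall>i\<in>{1..p}. \<alpha> i > -1) \<and>
     (\<forall>j\<in>{1..q}. \<beta> j > -1) \<and>
     (\<forall>i\<in>{1..p}. \<forall>j\<in>{1..q}. \<alpha> i + \<beta> j > -1) \<and>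
     (\<forall>i\<in>{1..p}. \<forall>h\<in>{1..p}. i \<noteq> h \<longrightarrow> \<alpha> i - \<alpha> h \<notin> \<int>) \<and>
     (\<forall>j\<in>{1..q}. \<forall>s\<in>{1..q}. j \<noteq> s \<longrightarrow> \<beta> j - \<beta> s \<notin> \<int>)"

text \<open>
  A form is a function on the open unit interval; values of \<open>B\<close> elsewhere are unconstrained.
  The integral is unaffected by the values at the two end points.
\<close>

definition typeII_pineiro_form ::
  "nat \<Rightarrow> nat \<Rightarrow> (nat \<Rightarrow> real) \<Rightarrow> (nat \<Rightarrow> real) \<Rightarrow> (nat \<Rightarrow> nat) \<Rightarrow> (nat \<Rightarrow> nat) \<Rightarrow>
   (real \<Rightarrow> real) \<Rightarrow> bool" where
  "typeII_pineiro_form p q \<alpha> \<beta> n m B \<longleftrightarrow>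
     (\<exists>P :: nat \<Rightarrow> real poly.
        (\<forall>j\<in>{1..q}. degree (P j) \<le> m j - 1 \<and> (m j = 0 \<longrightarrow> P j = 0)) \<and>
        (\<forall>x\<in>{0<..<1}. B x = (\<Sum>j=1..q. poly (P j) x * x powr \<beta> j))) \<and>
     (\<exists>x\<in>{0<..<1}. B x \<noteq> 0) \<and>
     (\<forall>i\<in>{1..p}. \<forall>k<n i. ((\<lambda>x. B x * x powr (real k + \<alpha> i)) has_integral 0) {0..1})"

definition clockwise_contour_around :: "complex set \<Rightarrow> (real \<Rightarrow> complex) \<Rightarrow> bool" where
  "clockwise_contour_around S \<gamma> \<longleftrightarrow>
     valid_path \<gamma> \<and> pathfinish \<gamma> = pathstart \<gamma> \<and>
     (\<forall>z\<in>S. z \<notin> path_image \<gamma> \<and> winding_number \<gamma> z = -1)"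

end

theory Submission
  imports Defs
begin

text \<open>
  Let \<open>S\<close> be the set of poles \<open>\<beta>\<^sub>j + k\<close> (\<open>k < m\<^sub>j\<close>) and \<open>R\<close> the set of zeros \<open>-\<alpha>\<^sub>i - k - 1\<close>
  (\<open>k < n\<^sub>i\<close>) of the rational factor \<open>N(t)/D(t)\<close> of the integrand, so that \<open>|S| = |R| + 1\<close>. Since
  \<open>deg N < deg D\<close>, partial fractions give \<open>N(t)/D(t) = \<Sum>\<^sub>s c\<^sub>s/(s - t)\<close>, and Cauchy's formula turns the
  contour integral into \<open>\<Sum>\<^sub>s c\<^sub>s x\<^sup>s\<close>. The moments of any \<open>\<Sum>\<^sub>s b\<^sub>s x\<^sup>s\<close> against \<open>x\<^sup>a\<close> are the values of
  \<open>\<Sum>\<^sub>s b\<^sub>s/(s - t) = M(t)/D(t)\<close> at \<open>t = -a - 1\<close>, where \<open>deg M \<le> |R|\<close>. Hence orthogonality says that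
  \<open>M\<close> vanishes on \<open>R\<close>, that is, \<open>M\<close> is a multiple of \<open>N\<close>.
\<close>

section \<open>Lagrange interpolation and partial fractions over a finite set of simple
  poles\<close>

lemma poly_prod_linear_minus:
  fixes S :: "'a::comm_ring_1 set"
  shows "poly (\<Prod>u\<in>S. [:u, -1:]) t = (\<Prod>u\<in>S. u - t)"
  by (simp add: poly_prod)

lemma poly_prod_linear_plus:
  fixes R :: "'a::comm_ring_1 set"
  shows "poly (\<Prod>r\<in>R. [:-r, 1:]) t = (\<Prod>r\<in>R. t - r)"
  by (simp add: poly_prod)

text \<open>The numerator of the sum of \<open>b s / (s - t)\<close> over the common denominator
  with factors \<open>u - t\<close>: an unnormalised Lagrange interpolant in
  \<open>t\<close>.\<close>

definition interp_poly :: "'a::field set \<Rightarrow> ('a \<Rightarrow> 'a) \<Rightarrow> 'a poly" where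
  "interp_poly S b = (\<Sum>s\<in>S. smult (b s) (\<Prod>u\<in>S - {s}. [:u, -1:]))"

lemma degree_interp_poly:
  assumes "finite S" "S \<noteq> {}"
  shows "degree (interp_poly S b) < card S"
proof -
  have "degree (interp_poly S b) \<le> card S - 1"
    unfolding interp_poly_def
  proof (rule degree_sum_le[OF assms(1)])
    fix s assume s: "s \<in> S"
    have "degree (\<Prod>u\<in>S - {s}. [:u, -1:]) \<le> (\<Sum>u\<in>S - {s}. degree [:u, -1:])"
      using degree_prod_sum_le[of "S - {s}" "\<lambda>u. [:u, -1:]"] assms(1) by (simp add: comp_def)
    also have "\<dots> = card S - 1"
      using s assms(1) by simp
    finally show "degree (smult (b s) (\<Prod>u\<in>S - {s}. [:u, -1:])) \<le> card S - 1"
      using degree_smult_le order_trans by blast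
  qed
  moreover have "card S > 0"
    using assms by (simp add: card_gt_0_iff)
  ultimately show ?thesis
    by linarith
qed

lemma poly_interp_poly_node:
  assumes "finite S" "s \<in> S"
  shows "poly (interp_poly S b) s = b s * (\<Prod>u\<in>S - {s}. u - s)"
proof -
  have "poly (interp_poly S b) s = (\<Sum>v\<in>S. b v * (\<Prod>u\<in>S - {v}. u - s))"
    by (simp add: interp_poly_def poly_sum poly_prod_linear_minus)
  also have "\<dots> = (\<Sum>v\<in>{s}. b v * (\<Prod>u\<in>S - {v}. u - s))"
    using assms by (intro sum.mono_neutral_right) auto
  finally show ?thesis by simp
qed

lemma poly_interp_poly_off_nodes:
  assumes "finite S" "t \<notin> S"
  shows "poly (interp_poly S b) t = (\<Prod>u\<in>S. u - t) * (\<Sum>s\<in>S. b s / (s - t))"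
proof -
  have "b s * (\<Prod>u\<in>S - {s}. u - t) = (\<Prod>u\<in>S. u - t) * (b s / (s - t))" if "s \<in> S" for s
  proof -
    have "s - t \<noteq> 0"
      using that assms(2) by auto
    then show ?thesis
      by (subst prod.remove[OF assms(1) that]) simp
  qed
  then show ?thesis
    by (simp add: interp_poly_def poly_sum poly_prod_linear_minus sum_distrib_left)
qed

text \<open>The value at \<open>s\<close> of the rational function after its factor
  \<open>s - t\<close> is cancelled, that is, minus its residue at \<open>s\<close>.\<close>

definition pf_coeff :: "'a::field set \<Rightarrow> 'a set \<Rightarrow> 'a \<Rightarrow> 'a" where
  "pf_coeff R S s = (\<Prod>r\<in>R. s - r) / (\<Prod>u\<in>S - {s}. u - s)"

lemma degree_prod_linear_plus:
  fixes R :: "'a::field set"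
  shows "finite R \<Longrightarrow> degree (\<Prod>r\<in>R. [:-r, 1:]) = card R"
  by (subst degree_prod_eq_sum_degree) auto

text \<open>Numerator and interpolant both have degree below \<open>card S\<close>, and the
  coefficients are chosen so that they agree at every node of \<open>S\<close>.\<close>

lemma partial_fractions:
  fixes R S :: "'a::field set"
  assumes "finite R" "finite S" "card R < card S" "t \<notin> S"
  shows "(\<Prod>r\<in>R. t - r) / (\<Prod>s\<in>S. s - t) = (\<Sum>s\<in>S. pf_coeff R S s / (s - t))"
proof -
  have "(\<Prod>r\<in>R. [:-r, 1:]) = interp_poly S (pf_coeff R S)"
  proof (rule poly_eqI_degree[where A = S])
    show "poly (\<Prod>r\<in>R. [:-r, 1:]) s = poly (interp_poly S (pf_coeff R S)) s" if "s \<in> S" for s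
      using assms(2) that
      by (simp add: poly_interp_poly_node poly_prod_linear_plus pf_coeff_def)
    show "card S > degree (\<Prod>r\<in>R. [:-r, 1:])"
      using assms by (simp add: degree_prod_linear_plus)
    show "card S > degree (interp_poly S (pf_coeff R S))"
      using assms by (intro degree_interp_poly) auto
  qed
  then have "(\<Prod>r\<in>R. t - r) = (\<Prod>s\<in>S. s - t) * (\<Sum>s\<in>S. pf_coeff R S s / (s - t))"
    using poly_interp_poly_off_nodes[OF assms(2,4)] by (metis poly_prod_linear_plus)
  moreover have "(\<Prod>s\<in>S. s - t) \<noteq> 0"
    using assms by auto
  ultimately show ?thesis by simp
qed

text \<open>The common numerator of the sum has degree at most \<open>card R\<close> and vanishes on
  \<open>R\<close>, which leaves one scalar free. One more point, taken from \<open>S\<close>,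
  determines that scalar.\<close>

lemma cauchy_kernel_unique:
  fixes R S :: "'a::field set"
  assumes "finite R" "finite S" "card S = card R + 1" "R \<inter> S = {}"
    and vanish: "\<And>r. r \<in> R \<Longrightarrow> (\<Sum>s\<in>S. b s / (s - r)) = 0"
  obtains c where "\<And>s. s \<in> S \<Longrightarrow> b s = c * pf_coeff R S s"
proof -
  let ?M = "interp_poly S b" and ?N = "\<Prod>r\<in>R. [:-r, 1:]"
  have "S \<noteq> {}"
    using assms(3) by auto
  then obtain s0 where s0: "s0 \<in> S" by blast
  \<comment> \<open>This choice makes \<open>?M\<close> and \<open>c\<close> times \<open>?N\<close>
    agree at \<open>s0\<close> as well; \<open>?N\<close> is nonzero there because \<open>R\<close>
    and \<open>S\<close> are disjoint.\<close>
  define c where "c = poly ?M s0 / poly ?N s0"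
  have N_nz: "poly ?N s \<noteq> 0" if "s \<in> S" for s
    using assms(1,4) that by (auto simp: poly_prod_linear_plus)
  have card: "card (insert s0 R) = card R + 1"
    using assms(1,4) s0 by (subst card_insert_disjoint) auto
  have "?M = smult c ?N"
  proof (rule poly_eqI_degree[where A = "insert s0 R"])
    show "poly ?M t = poly (smult c ?N) t" if "t \<in> insert s0 R" for t
    proof (cases "t = s0")
      case True
      then show ?thesis using N_nz[OF s0] by (simp add: c_def)
    next
      case False
      then have t: "t \<in> R" using that by simp
      then have "poly ?N t = 0"
        using assms(1) by (auto simp: poly_prod_linear_plus)
      moreover have "t \<notin> S" using t assms(4) by auto
      ultimately show ?thesis
        using vanish[OF t] by (simp add: poly_interp_poly_off_nodes[OF assms(2)])
    qed
    show "card (insert s0 R) > degree ?M"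
      using degree_interp_poly[OF assms(2) \<open>S \<noteq> {}\<close>, of b] card assms(3) by simp
    show "card (insert s0 R) > degree (smult c ?N)"
      using degree_smult_le[of c ?N] card degree_prod_linear_plus[OF assms(1)] by linarith
  qed
  show thesis
  proof
    fix s assume s: "s \<in> S"
    have "b s * (\<Prod>u\<in>S - {s}. u - s) = c * (\<Prod>r\<in>R. s - r)"
      using poly_interp_poly_node[OF assms(2) s, of b] \<open>?M = smult c ?N\<close>
      by (simp add: poly_prod_linear_plus)
    moreover have "(\<Prod>u\<in>S - {s}. u - s) \<noteq> 0"
      using assms(2) by auto
    ultimately show "b s = c * pf_coeff R S s"
      by (simp add: pf_coeff_def field_simps)
  qed
qed

text \<open>Links the complex poles of the contour integral to the real exponents of the
  form.\<close>

lemma pf_coeff_of_real: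
  "pf_coeff (of_real ` R) (of_real ` S) (of_real s) = (of_real (pf_coeff R S s) :: 'a::real_field)"
proof -
  have "of_real ` S - {of_real s} = (of_real ` (S - {s}) :: 'a set)" by auto
  then show ?thesis
    by (simp add: pf_coeff_def prod.reindex inj_on_def)
qed

section \<open>The contour integral and the moments of power sums\<close>

text \<open>After partial fractions, Cauchy's formula applies to one pole at a time. The exponential
  is entire and the whole plane is convex, so any closed path avoiding the pole is
  admissible.\<close>

lemma contour_integral_exp_over_nodes:
  fixes S :: "complex set"
  assumes "finite R" "finite S" "card R < card S" and \<gamma>: "clockwise_contour_around S \<gamma>"
  shows "contour_integral \<gamma> (\<lambda>t. exp (t * y) * (\<Prod>r\<in>R. t - r) / (\<Prod>s\<in>S. s - t))
           / (2 * of_real pi * \<i>) = (\<Sum>s\<in>S. pf_coeff R S s * exp (s * y))"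
proof -
  have "((\<lambda>t. \<Sum>s\<in>S. - pf_coeff R S s * (exp (t * y) / (t - s))) has_contour_integral
          (\<Sum>s\<in>S. - pf_coeff R S s * (2 * of_real pi * \<i> * winding_number \<gamma> s * exp (s * y)))) \<gamma>"
  proof (intro has_contour_integral_sum has_contour_integral_lmul)
    fix s assume "s \<in> S"
    then have "((\<lambda>t. exp (t * y) / (t - s)) has_contour_integral
                  of_real (2 * pi) * \<i> * winding_number \<gamma> s * exp (s * y)) \<gamma>"
      using \<gamma> unfolding clockwise_contour_around_def
      by (intro Cauchy_integral_formula_convex_simple[where S = UNIV])
         (auto intro!: holomorphic_intros)
    then show "((\<lambda>t. exp (t * y) / (t - s)) has_contour_integral
                  2 * of_real pi * \<i> * winding_number \<gamma> s * exp (s * y)) \<gamma>"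
      by simp
  qed (use assms in auto)
  \<comment> \<open>Winding number -1 cancels the sign that came from writing \<open>s - t\<close>
    as \<open>-(t - s)\<close>.\<close>
  also have "(\<Sum>s\<in>S. - pf_coeff R S s * (2 * of_real pi * \<i> * winding_number \<gamma> s * exp (s * y)))
      = (\<Sum>s\<in>S. pf_coeff R S s * exp (s * y)) * (2 * of_real pi * \<i>)"
    unfolding sum_distrib_right
    using \<gamma> by (intro sum.cong) (auto simp: clockwise_contour_around_def algebra_simps)
  finally have "((\<lambda>t. exp (t * y) * (\<Prod>r\<in>R. t - r) / (\<Prod>s\<in>S. s - t)) has_contour_integral
      (\<Sum>s\<in>S. pf_coeff R S s * exp (s * y)) * (2 * of_real pi * \<i>)) \<gamma>"
  proof (rule has_contour_integral_eq)
    fix t assume "t \<in> path_image \<gamma>"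
    then have t: "t \<notin> S"
      using \<gamma> by (auto simp: clockwise_contour_around_def)
    have "(\<Sum>s\<in>S. - pf_coeff R S s * (exp (t * y) / (t - s)))
        = exp (t * y) * (\<Sum>s\<in>S. pf_coeff R S s / (s - t))"
      unfolding sum_distrib_left
    proof (rule sum.cong[OF refl])
      fix s assume "s \<in> S"
      then have "s - t \<noteq> 0" "t - s \<noteq> 0" using t by auto
      then show "- pf_coeff R S s * (exp (t * y) / (t - s))
          = exp (t * y) * (pf_coeff R S s / (s - t))"
        by (simp add: field_simps)
    qed
    then show "(\<Sum>s\<in>S. - pf_coeff R S s * (exp (t * y) / (t - s)))
        = exp (t * y) * (\<Prod>r\<in>R. t - r) / (\<Prod>s\<in>S. s - t)"
      by (simp add: partial_fractions[OF assms(1-3) t, symmetric])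
  qed
  then show ?thesis
    by (simp add: contour_integral_unique)
qed

text \<open>Each power contributes \<open>1 / (s + a + 1)\<close>, written here as the Cauchy kernel
  at the point \<open>- a - 1\<close>.\<close>

lemma has_integral_powr_sum_moment:
  fixes B b :: "real \<Rightarrow> real"
  assumes "finite S" and B: "\<And>x. x \<in> {0<..<1} \<Longrightarrow> B x = (\<Sum>s\<in>S. b s * x powr s)"
    and gt: "\<And>s. s \<in> S \<Longrightarrow> s + a > -1"
  shows "((\<lambda>x. B x * x powr a) has_integral (\<Sum>s\<in>S. b s / (s - (- a - 1)))) {0..1}"
proof -
  have "((\<lambda>x. \<Sum>s\<in>S. b s * x powr (s + a)) has_integral (\<Sum>s\<in>S. b s * (1 / (s + a + 1)))) {0..1}"
  proof (intro has_integral_sum has_integral_mult_right)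
    fix s assume "s \<in> S"
    then show "((\<lambda>x. x powr (s + a)) has_integral 1 / (s + a + 1)) {0..1}"
      using has_integral_powr_from_0[of "s + a" 1] gt by simp
  qed (use assms in auto)
  then have "((\<lambda>x. B x * x powr a) has_integral (\<Sum>s\<in>S. b s * (1 / (s + a + 1)))) {0..1}"
    \<comment> \<open>The formula for \<open>B\<close> holds only inside the interval, so both end
      points are discarded.\<close>
    by (rule has_integral_spike_finite[of "{0, 1}", rotated 2])
       (auto simp: B sum_distrib_right powr_add mult.assoc)
  then show ?thesis
    by (simp add: algebra_simps)
qed

text \<open>
  Poles and zeros are handled as plain sets of reals; the noninteger gaps ensure that all of them
  are simple.
\<close>

definition nodes :: "nat \<Rightarrow> (nat \<Rightarrow> real) \<Rightarrow> (nat \<Rightarrow> nat) \<Rightarrow> real set" where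
  "nodes p \<theta> n = (\<lambda>(i, k). \<theta> i + real k) ` (SIGMA i:{1..p}. {..<n i})"

definition noninteger_gaps :: "nat \<Rightarrow> (nat \<Rightarrow> real) \<Rightarrow> bool" where
  "noninteger_gaps p \<theta> \<longleftrightarrow> (\<forall>i\<in>{1..p}. \<forall>h\<in>{1..p}. i \<noteq> h \<longrightarrow> \<theta> i - \<theta> h \<notin> \<int>)"

lemma finite_nodes [simp]: "finite (nodes p \<theta> n)"
  by (simp add: nodes_def)

lemma inj_on_nodes:
  assumes "noninteger_gaps p \<theta>"
  shows "inj_on (\<lambda>(i, k). \<theta> i + real k) (SIGMA i:{1..p}. {..<n i})"
proof (rule inj_onI, clarify)
  fix i k h l
  assume i: "i \<in> {1..p}" and h: "h \<in> {1..p}" and eq: "\<theta> i + real k = \<theta> h + real l"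
  have "\<theta> i - \<theta> h = of_int (int l - int k)"
    using eq by simp
  then have "\<theta> i - \<theta> h \<in> \<int>"
    by (metis Ints_of_int)
  then have "i = h"
    using assms i h unfolding noninteger_gaps_def by blast
  then show "i = h \<and> k = l"
    using eq by simp
qed

lemma card_nodes:
  assumes "noninteger_gaps p \<theta>"
  shows "card (nodes p \<theta> n) = (\<Sum>i=1..p. n i)"
  unfolding nodes_def card_image[OF inj_on_nodes[OF assms]] by simp

lemma sum_nodes:
  fixes f :: "real \<Rightarrow> 'a::comm_monoid_add"
  assumes "noninteger_gaps p \<theta>"
  shows "(\<Sum>s\<in>nodes p \<theta> n. f s) = (\<Sum>i=1..p. \<Sum>k<n i. f (\<theta> i + real k))"
  unfolding nodes_def sum.reindex[OF inj_on_nodes[OF assms]]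
  by (simp add: sum.Sigma split_def)

lemma prod_nodes:
  fixes f :: "real \<Rightarrow> 'a::comm_monoid_mult"
  assumes "noninteger_gaps p \<theta>"
  shows "(\<Prod>s\<in>nodes p \<theta> n. f s) = (\<Prod>i=1..p. \<Prod>k<n i. f (\<theta> i + real k))"
  unfolding nodes_def prod.reindex[OF inj_on_nodes[OF assms]]
  by (simp add: prod.Sigma split_def)

text \<open>Expanding the polynomials into monomials replaces them by one coefficient per node, the
  shape that the partial fraction lemmas work with.\<close>

lemma poly_powr_sum_iff_nodes:
  assumes "noninteger_gaps q \<beta>"
  shows "(\<exists>P :: nat \<Rightarrow> real poly.
        (\<forall>j\<in>{1..q}. degree (P j) \<le> m j - 1 \<and> (m j = 0 \<longrightarrow> P j = 0)) \<and>
        (\<forall>x\<in>{0<..<1}. B x = (\<Sum>j=1..q. poly (P j) x * x powr \<beta> j))) \<longleftrightarrow>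
     (\<exists>b. \<forall>x\<in>{0<..<1}. B x = (\<Sum>s\<in>nodes q \<beta> m. b s * x powr s))"
    (is "(\<exists>P. ?deg P \<and> ?poly P) \<longleftrightarrow> (\<exists>b. ?powr b)")
proof
  assume "\<exists>P. ?deg P \<and> ?poly P"
  then obtain P where deg: "?deg P" and P: "?poly P" by blast
  \<comment> \<open>Recovers the pair \<open>(j, k)\<close> from the real number
    \<open>\<beta> j + real k\<close>; injectivity makes this unambiguous.\<close>
  define pos where "pos = inv_into (SIGMA j:{1..q}. {..<m j}) (\<lambda>(j, k). \<beta> j + real k)"
  define b where "b s = coeff (P (fst (pos s))) (snd (pos s))" for s
  have b: "b (\<beta> j + real k) = coeff (P j) k" if "j \<in> {1..q}" "k < m j" for j k
    using inv_into_f_f[OF inj_on_nodes[OF assms], of "(j, k)" m] that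
    by (simp add: b_def pos_def)
  have "poly (P j) x * x powr \<beta> j = (\<Sum>k<m j. b (\<beta> j + real k) * x powr (\<beta> j + real k))"
    if j: "j \<in> {1..q}" and x: "x \<in> {0<..<1}" for j x
  proof -
    have "poly (P j) x = (\<Sum>k<m j. coeff (P j) k * x ^ k)"
    \<comment> \<open>With truncated subtraction the degree bound for \<open>m j = 0\<close> still
      admits constants, so the separate condition \<open>P j = 0\<close> is used.\<close>
    proof (cases "m j = 0")
      case True
      then show ?thesis using deg j by simp
    next
      case False
      then have "degree (P j) < m j" using deg j by fastforce
      then show ?thesis
        unfolding poly_altdef
        by (intro sum.mono_neutral_left) (auto simp: coeff_eq_0)
    qed
    then show ?thesis
      using x j by (simp add: b sum_distrib_left powr_add powr_realpow mult_ac)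
  qed
  then have "?powr b"
    using P by (simp add: sum_nodes[OF assms])
  then show "\<exists>b. ?powr b" by blast
next
  assume "\<exists>b. ?powr b"
  then obtain b where b: "?powr b" by blast
  define P where "P j = (\<Sum>k<m j. monom (b (\<beta> j + real k)) k)" for j
  have "?deg P"
  proof
    fix j
    have "degree (P j) \<le> m j - 1"
      unfolding P_def
      by (rule degree_sum_le) (auto intro: order_trans[OF degree_monom_le])
    then show "degree (P j) \<le> m j - 1 \<and> (m j = 0 \<longrightarrow> P j = 0)"
      by (simp add: P_def)
  qed
  moreover have "?poly P"
    using b
    by (simp add: sum_nodes[OF assms] P_def poly_sum poly_monom sum_distrib_left powr_add
        powr_realpow mult_ac)
  ultimately show "\<exists>P. ?deg P \<and> ?poly P" by blast
qed

text \<open>If the sum vanished, so would all its moments, including those with real exponent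
  \<open>- t - 1\<close>. The rational function would then be zero at a point \<open>t\<close>
  outside \<open>R\<close>, where its numerator is not.\<close>

lemma powr_sum_nonzero:
  fixes R S :: "real set"
  assumes "finite R" "finite S" "card R < card S" and pos: "\<And>s. s \<in> S \<Longrightarrow> s > -1"
  shows "\<exists>x\<in>{0<..<1}. (\<Sum>s\<in>S. pf_coeff R S s * x powr s) \<noteq> 0"
proof (rule ccontr)
  assume "\<not> ?thesis"
  then have zero: "0 = (\<Sum>s\<in>S. pf_coeff R S s * x powr s)" if "x \<in> {0<..<1}" for x
    using that by auto
  have "infinite ({..-1} - R)"
    using assms(1) by (simp add: infinite_Iic)
  \<comment> \<open>The bound \<open>t \<le> -1\<close> keeps \<open>t\<close> below all of
    \<open>S\<close>, which gives both integrability and \<open>t \<notin> S\<close>.\<close>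
  then obtain t where t: "t \<le> -1" "t \<notin> R"
    by (metis DiffE atMost_iff ex_in_conv finite.emptyI)
  have "((\<lambda>x. 0 * x powr (- t - 1)) has_integral
          (\<Sum>s\<in>S. pf_coeff R S s / (s - (- (- t - 1) - 1)))) {0..1}"
  proof (rule has_integral_powr_sum_moment[where B = "\<lambda>_. 0", OF assms(2) zero])
    show "s + (- t - 1) > -1" if "s \<in> S" for s
      using pos[OF that] t(1) by linarith
  qed
  then have "(\<Sum>s\<in>S. pf_coeff R S s / (s - t)) = 0"
    by (simp add: has_integral_iff)
  moreover have "t \<notin> S"
    using pos t(1) by fastforce
  ultimately have "(\<Prod>r\<in>R. t - r) / (\<Prod>s\<in>S. s - t) = 0"
    using partial_fractions[OF assms(1-3), of t] by simp
  then show False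
    using assms(1,2) t(2) \<open>t \<notin> S\<close> by auto
qed

section \<open>Existence, uniqueness and the contour representation of the form\<close>

theorem proposition5p4:
  fixes p q :: nat and \<alpha> \<beta> :: "nat \<Rightarrow> real" and n m :: "nat \<Rightarrow> nat"
    and \<gamma> :: "real \<Rightarrow> complex"
  assumes "pineiro_params p q \<alpha> \<beta>"
    and "(\<Sum>j=1..q. m j) = (\<Sum>i=1..p. n i) + 1"
    and "clockwise_contour_around
           {complex_of_real (\<beta> j) + of_nat k | j k. j \<in> {1..q} \<and> k < m j} \<gamma>"
  shows "(\<exists>B. typeII_pineiro_form p q \<alpha> \<beta> n m B) \<and>
    (\<forall>B. typeII_pineiro_form p q \<alpha> \<beta> n m B \<longrightarrow>
      (\<exists>c::real. c \<noteq> 0 \<and>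
        (\<forall>x\<in>{0<..<1}.
          complex_of_real (B x) = complex_of_real c *
            (contour_integral \<gamma>
              (\<lambda>t. exp (t * complex_of_real (ln x)) *
                   (\<Prod>i=1..p. pochhammer (t + complex_of_real (\<alpha> i) + 1) (n i)) /
                   (\<Prod>j=1..q. pochhammer (complex_of_real (\<beta> j) - t) (m j)))
             / (2 * complex_of_real pi * \<i>)))))"
proof -
  have gaps: "noninteger_gaps p \<alpha>" "noninteger_gaps q \<beta>"
    using assms(1) by (auto simp: pineiro_params_def noninteger_gaps_def)
  define S where "S = nodes q \<beta> m"
  define A where "A = nodes p \<alpha> n"
  \<comment> \<open>The moment against \<open>x powr a\<close> is evaluated at
    \<open>- a - 1\<close>; these points are also the zeros of the Pochhammer numerator.\<close>
  define R where "R = (\<lambda>a. - a - 1) ` A"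
  have fin: "finite R" "finite S"
    by (simp_all add: R_def S_def A_def)
  have card: "card S = card R + 1"
    using assms(2) gaps by (simp add: R_def S_def A_def card_nodes card_image inj_on_def)
  have S_gt: "s > -1" if "s \<in> S" for s
    using that assms(1) by (force simp: S_def nodes_def pineiro_params_def)
  have AS_gt: "s + a > -1" if sa: "s \<in> S" "a \<in> A" for s a
  proof -
    obtain j k i l where "s = \<beta> j + real k" "a = \<alpha> i + real l" "j \<in> {1..q}" "i \<in> {1..p}"
      using sa unfolding S_def A_def nodes_def by fast
    moreover from this have "\<alpha> i + \<beta> j > -1"
      using assms(1) by (simp add: pineiro_params_def)
    ultimately show ?thesis by simp
  qed
  \<comment> \<open>A common point would give \<open>s + a = -1\<close>, against the strict bound
    \<open>AS_gt\<close>.\<close>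
  have disj: "R \<inter> S = {}"
    using AS_gt by (force simp: R_def)
  \<comment> \<open>The real function that the contour integral will turn out to be.\<close>
  define F where "F x = (\<Sum>s\<in>S. pf_coeff R S s * x powr s)" for x
  \<comment> \<open>The moments exist with known values, so uniqueness of the integral turns
    orthogonality into an equivalent algebraic condition.\<close>
  have orth: "(\<forall>i\<in>{1..p}. \<forall>k<n i. ((\<lambda>x. B x * x powr (real k + \<alpha> i)) has_integral 0) {0..1})
      \<longleftrightarrow> (\<forall>r\<in>R. (\<Sum>s\<in>S. b s / (s - r)) = 0)"
    if B: "\<And>x. x \<in> {0<..<1} \<Longrightarrow> B x = (\<Sum>s\<in>S. b s * x powr s)" for B b
  proof -
    have "((\<lambda>x. B x * x powr a) has_integral 0) {0..1} \<longleftrightarrow> (\<Sum>s\<in>S. b s / (s - (- a - 1))) = 0"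
      if "a \<in> A" for a
      using has_integral_powr_sum_moment[OF fin(2) B, of a] AS_gt[OF _ that]
      by (metis has_integral_unique)
    then have "(\<forall>a\<in>A. ((\<lambda>x. B x * x powr a) has_integral 0) {0..1})
        \<longleftrightarrow> (\<forall>r\<in>R. (\<Sum>s\<in>S. b s / (s - r)) = 0)"
      by (simp add: R_def)
    then show ?thesis
      by (auto simp: A_def nodes_def add.commute)
  qed
  have form_F: "typeII_pineiro_form p q \<alpha> \<beta> n m F"
    unfolding typeII_pineiro_form_def poly_powr_sum_iff_nodes[OF gaps(2)]
  proof (intro conjI)
    show "\<exists>b. \<forall>x\<in>{0<..<1}. F x = (\<Sum>s\<in>nodes q \<beta> m. b s * x powr s)"
      using F_def S_def by blast
    show "\<exists>x\<in>{0<..<1}. F x \<noteq> 0"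
      unfolding F_def using fin card S_gt by (intro powr_sum_nonzero) auto
    have "(\<Sum>s\<in>S. pf_coeff R S s / (s - r)) = 0" if "r \<in> R" for r
    proof -
      have "(\<Prod>v\<in>R. r - v) = 0"
        using fin(1) that by auto
      moreover have "r \<notin> S"
        using disj that by auto
      ultimately show ?thesis
        using partial_fractions[OF fin, of r] card by simp
    qed
    then show "\<forall>i\<in>{1..p}. \<forall>k<n i. ((\<lambda>x. F x * x powr (real k + \<alpha> i)) has_integral 0) {0..1}"
      using orth[of F "pf_coeff R S"] F_def by blast
  qed
  have form_unique: "\<exists>c. c \<noteq> 0 \<and> (\<forall>x\<in>{0<..<1}. B x = c * F x)"
    if form: "typeII_pineiro_form p q \<alpha> \<beta> n m B" for B
  proof -
    obtain b where b: "\<And>x. x \<in> {0<..<1} \<Longrightarrow> B x = (\<Sum>s\<in>S. b s * x powr s)"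
      using form unfolding typeII_pineiro_form_def poly_powr_sum_iff_nodes[OF gaps(2)] S_def
      by blast
    have "\<forall>r\<in>R. (\<Sum>s\<in>S. b s / (s - r)) = 0"
      using form orth[OF b] unfolding typeII_pineiro_form_def by blast
    then obtain c where c: "\<And>s. s \<in> S \<Longrightarrow> b s = c * pf_coeff R S s"
      using cauchy_kernel_unique[OF fin card disj, of b] by blast
    have BF: "\<forall>x\<in>{0<..<1}. B x = c * F x"
      by (simp add: b c F_def sum_distrib_left mult.assoc)
    \<comment> \<open>Otherwise \<open>B\<close> would vanish on the whole open interval.\<close>
    moreover have "c \<noteq> 0"
      using BF form by (auto simp: typeII_pineiro_form_def)
    ultimately show ?thesis by blast
  qed
  have contour: "contour_integral \<gamma>
              (\<lambda>t. exp (t * complex_of_real (ln x)) *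
                   (\<Prod>i=1..p. pochhammer (t + complex_of_real (\<alpha> i) + 1) (n i)) /
                   (\<Prod>j=1..q. pochhammer (complex_of_real (\<beta> j) - t) (m j)))
             / (2 * complex_of_real pi * \<i>) = complex_of_real (F x)"
    if x: "x \<in> {0<..<1}" for x
  proof -
    let ?S = "complex_of_real ` S" and ?R = "complex_of_real ` R"
    have num: "(\<Prod>i=1..p. pochhammer (t + complex_of_real (\<alpha> i) + 1) (n i)) = (\<Prod>r\<in>?R. t - r)" for t
      by (simp add: R_def A_def prod.reindex inj_on_def prod_nodes[OF gaps(1)] pochhammer_prod
          atLeast0LessThan algebra_simps)
    have den: "(\<Prod>j=1..q. pochhammer (complex_of_real (\<beta> j) - t) (m j)) = (\<Prod>s\<in>?S. s - t)" for t
      by (simp add: S_def prod.reindex inj_on_def prod_nodes[OF gaps(2)] pochhammer_prod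
          atLeast0LessThan algebra_simps)
    have "{complex_of_real (\<beta> j) + of_nat k | j k. j \<in> {1..q} \<and> k < m j} = ?S"
      by (force simp: S_def nodes_def image_iff)
    then have "clockwise_contour_around ?S \<gamma>"
      using assms(3) by simp
    moreover have "card ?R < card ?S"
      using card by (simp add: card_image inj_on_def)
    ultimately have "contour_integral \<gamma> (\<lambda>t. exp (t * of_real (ln x)) * (\<Prod>r\<in>?R. t - r) / (\<Prod>s\<in>?S. s - t))
        / (2 * of_real pi * \<i>) = (\<Sum>s\<in>?S. pf_coeff ?R ?S s * exp (s * of_real (ln x)))"
      using fin by (intro contour_integral_exp_over_nodes) auto
    \<comment> \<open>For \<open>x > 0\<close> the exponential of \<open>s * ln x\<close> is
      \<open>x powr s\<close>, and the coefficients are real.\<close>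
    also have "\<dots> = of_real (F x)"
      using x by (simp add: sum.reindex inj_on_def pf_coeff_of_real F_def powr_def
          flip: exp_of_real)
    finally show ?thesis
      by (simp only: num den)
  qed
  show ?thesis
  proof (intro conjI allI impI)
    show "\<exists>B. typeII_pineiro_form p q \<alpha> \<beta> n m B"
      using form_F by blast
  next
    fix B assume "typeII_pineiro_form p q \<alpha> \<beta> n m B"
    from form_unique[OF this] obtain c where "c \<noteq> 0" and c: "\<And>x. x \<in> {0<..<1} \<Longrightarrow> B x = c * F x"
      by blast
    show "\<exists>c. c \<noteq> 0 \<and> (\<forall>x\<in>{0<..<1}. complex_of_real (B x) = complex_of_real c *
            (contour_integral \<gamma>
              (\<lambda>t. exp (t * complex_of_real (ln x)) *
                   (\<Prod>i=1..p. pochhammer (t + complex_of_real (\<alpha> i) + 1) (n i)) /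
                   (\<Prod>j=1..q. pochhammer (complex_of_real (\<beta> j) - t) (m j)))
             / (2 * complex_of_real pi * \<i>)))"
    proof (intro exI conjI ballI)
      show "c \<noteq> 0" by fact
    qed (simp only: contour c of_real_mult)
  qed
qed

end
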